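(* Let $f\in\mathbb{R}[x]=\mathbb{R}[x_1,\dots,x_n]$, let $G(x)$ be an $m\times m$ symmetric polynomial matrix, $l=\lceil\deg(G)/2\rceil$, and consider the problem of minimizing $f$ over $\mathcal{X}=\{x\in B^n:G(x)\succeq0\}$, where $B^n=\{x\in\mathbb{R}^n:\sum_ix_i^2\le1\}$. Assume that the spectral radius of $G(x)$ is at most $1$ for all $x\in B^n$. For an integer $r\ge l$ (with $\deg f\le2r$), the dual of the SDP problem corresponding to the hierarchy $$\mathrm{lb}(f,\overline{\mathcal{Q}}(\mathcal{X}))_r=\max\{t\in\mathbb{R}:f-t\in\overline{\mathcal{Q}}(\mathcal{X})_{2r}\}$$ is given by $$\begin{aligned}\min_{y\in\mathbb{R}^{s(n,2r)}}\ & L_y(f)\\ \text{subject to}\ & y_0=1,\ \mathbf{M}_r(y)\succeq0,\ \mathbf{M}_{r-1}\Big(\big(1-\textstyle\sum_{i=1}^nx_i^2\big)y\Big)\succeq0,\\ & L_y\big(P^G_{\lceil(\lfloor r/l\rfloor-1)/2\rceil}\big)\succeq0,\quad L_y\big(Q^G_{\lceil(\lfloor r/l\rfloor-1)/2\rceil-1}\big)\succeq0.\end{aligned}$$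
   Context: Notation: $\deg G$ is the maximum degree of the entries of $G$; $\mathbb{N}^n_r=\{\alpha\in\mathbb{N}^n:|\alpha|\le r\}$, $s(n,r)=\binom{n+r}{n}=|\mathbb{N}^n_r|$; $b_r(x)=(x^\alpha)_{\alpha\in\mathbb{N}^n_r}$ is the column vector of monomials of degree at most $r$; $\langle A,B\rangle=\mathrm{tr}(A^\top B)$. For $h(t)=\sum_ih_it^i\in\mathbb{R}[t]$, $h(G(x))=\sum_ih_iG(x)^i$ with $G(x)^0=I_m$. For a sequence $y=(y_\alpha)$ indexed by monomial exponents, the Riesz functional is $L_y(\sum_\alpha p_\alpha x^\alpha)=\sum_\alpha p_\alpha y_\alpha$, and $L_y$ acts entrywise on polynomial matrices. $\mathbf{M}_r(y)=L_y(b_rb_r^\top)$ is the moment matrix and $\mathbf{M}_{r-1}(gy)=L_y(g\,b_{r-1}b_{r-1}^\top)$ is the localizing matrix of a polynomial $g$. For an integer $v\ge0$, $P^G_v(x)$ and $Q^G_v(x)$ are the $(v+1)\times(v+1)$ polynomial matrices with entries, for $0\le i,j\le v$, $$[P^G_v(x)]_{i,j}=\mathrm{tr}(G(x)^{i+j+1}),\qquad[Q^G_v(x)]_{i,j}=\mathrm{tr}(G(x)^{i+j+1})-\mathrm{tr}(G(x)^{i+j+3});$$ $Q^G_{-1}$ is the empty matrix (the corresponding variable and constraint are absent). $\overline{\mathcal{Q}}(\mathcal{X})_{2r}=\mathcal{Q}(B^n)_{2r}+\mathcal{H}(G)_{\lfloor r/l\rfloor-1}$, where $\mathcal{Q}(B^n)_{2r}$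 is the set of polynomials $\sigma_0+\sigma_1(1-\sum_ix_i^2)$ with $\sigma_0,\sigma_1$ sums of squares, $\deg\sigma_0\le2r$, $\deg\sigma_1\le2r-2$, and $\mathcal{H}(G)_k=\{\langle h(G(x)),G(x)\rangle:h\in\mathbb{R}[t],\ \deg h\le k,\ h\ge0\text{ on }[-1,1]\}$. With $k=\lfloor r/l\rfloor-1$, the SDP corresponding to the hierarchy is obtained by writing $h(t)=h_1(t)+(1-t^2)h_2(t)$ with $h_1,h_2$ univariate sums of squares of degrees at most $2\lceil k/2\rceil$ and $2\lceil k/2\rceil-2$, represented by Gram matrices $Y$ and $Z$: maximize $t$ subject to $$f(x)-t=\langle X,b_rb_r^\top\rangle+\Big\langle X_1,\Big(1-\sum_{i=1}^nx_i^2\Big)b_{r-1}b_{r-1}^\top\Big\rangle+\langle Y,P^G_{\lceil k/2\rceil}(x)\rangle+\langle Z,Q^G_{\lceil k/2\rceil-1}(x)\rangle$$ (imposed coefficientwise for $\alpha\in\mathbb{N}^n_{2r}$), with $X,X_1,Y,Z\succeq0$ of sizes $s(n,r)$, $s(n,r-1)$, $\lceil k/2\rceil+1$, $\lceil k/2\rceil$; here $P^G_{\lceil k/2\rceil}$ and $Q^G_{\lceil k/2\rceil-1}$ are expanded as $\sum_{\alpha\in\mathbb{N}^n_{2r}}P_\alpha x^\alpha$ and $\sum_{\alpha\in\mathbb{N}^n_{2r}}Q_\alpha x^\alpha$. "Dual" means the standard conic dual, with $y_\alpha$ the multiplier of the $\alpha$-th coefficient identity. *)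

theory Defs
  imports "HOL-Library.Poly_Mapping" "Jordan_Normal_Form.Spectral_Radius"
begin

section \<open>Multivariate polynomials\<close>

text \<open>
  The finite index type \<open>'n\<close> plays the role of \<open>{1, ..., n}\<close>. An exponent \<open>\<alpha>\<close> is a map
  from variables to natural numbers, and a polynomial is a finitely supported map from exponents
  to coefficients; the ring operations are those of \<^theory>\<open>HOL-Library.Poly_Mapping\<close>.
\<close>

type_synonym 'n expo = "'n \<Rightarrow>\<^sub>0 nat"
type_synonym 'n rpoly = "'n expo \<Rightarrow>\<^sub>0 real"

definition expo_deg :: "('n::finite) expo \<Rightarrow> nat" where
  "expo_deg \<alpha> = (\<Sum>i\<in>UNIV. Poly_Mapping.lookup \<alpha> i)"

definition expos :: "nat \<Rightarrow> ('n::finite) expo set" where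
  "expos r = {\<alpha>. expo_deg \<alpha> \<le> r}"

text \<open>The total degree; the zero polynomial gets degree \<open>0\<close>.\<close>

definition pdeg :: "('n::finite) rpoly \<Rightarrow> nat" where
  "pdeg p = Max (insert 0 (expo_deg ` Poly_Mapping.keys p))"

definition pconst :: "real \<Rightarrow> 'n rpoly" where
  "pconst c = Poly_Mapping.single 0 c"

definition xpow :: "'n expo \<Rightarrow> 'n rpoly" where
  "xpow \<alpha> = Poly_Mapping.single \<alpha> 1"

definition xvar :: "'n \<Rightarrow> 'n rpoly" where
  "xvar i = xpow (Poly_Mapping.single i 1)"

definition peval :: "('n::finite \<Rightarrow> real) \<Rightarrow> 'n rpoly \<Rightarrow> real" where
  "peval x p = (\<Sum>\<alpha>\<in>Poly_Mapping.keys p. Poly_Mapping.lookup p \<alpha> * (\<Prod>i\<in>UNIV. x i ^ Poly_Mapping.lookup \<alpha> i))"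

definition ball_poly :: "('n::finite) rpoly" where
  "ball_poly = 1 - (\<Sum>i\<in>UNIV. xvar i ^ 2)"


section \<open>Polynomial matrices\<close>

definition mat_deg :: "('n::finite) rpoly mat \<Rightarrow> nat" where
  "mat_deg G = Max {pdeg (G $$ (i, j)) | i j. i < dim_row G \<and> j < dim_col G}"

definition mat_trace :: "'a::comm_monoid_add mat \<Rightarrow> 'a" where
  "mat_trace A = (\<Sum>i<dim_row A. A $$ (i, i))"

text \<open>The value \<open>G(x)\<close>, as a complex matrix because \<^const>\<open>spectral_radius\<close> is defined for those.\<close>

definition mat_eval :: "('n::finite \<Rightarrow> real) \<Rightarrow> 'n rpoly mat \<Rightarrow> complex mat" where
  "mat_eval x G = map_mat (\<lambda>p. complex_of_real (peval x p)) G"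

text \<open>
  Matrices whose rows and columns are indexed by a finite set \<open>S\<close> (exponents, or numbers
  \<open>{0..v}\<close>) are binary functions, relevant on \<open>S \<times> S\<close>. Thus \<open>P\<^sup>G\<^sub>v\<close> is \<open>P_mat G\<close> on \<open>{..v}\<close>
  and \<open>Q\<^sup>G\<^sub>v\<close> is \<open>Q_mat G\<close> on \<open>{..v} = {..<v+1}\<close>, where the empty matrix \<open>Q\<^sup>G\<close> with
  \<open>v = -1\<close> corresponds to the index set \<open>{..<0} = {}\<close>.
\<close>

definition P_mat :: "'n rpoly mat \<Rightarrow> nat \<Rightarrow> nat \<Rightarrow> 'n rpoly" where
  "P_mat G i j = mat_trace (G ^\<^sub>m (i + j + 1))"

definition Q_mat :: "'n rpoly mat \<Rightarrow> nat \<Rightarrow> nat \<Rightarrow> 'n rpoly" where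
  "Q_mat G i j = mat_trace (G ^\<^sub>m (i + j + 1)) - mat_trace (G ^\<^sub>m (i + j + 3))"

text \<open>\<open>g \<cdot> b b\<^sup>T\<close>, where \<open>b\<close> is the vector of monomials.\<close>

definition mono_mat :: "'n rpoly \<Rightarrow> 'n expo \<Rightarrow> 'n expo \<Rightarrow> 'n rpoly" where
  "mono_mat g \<alpha> \<beta> = g * (xpow \<alpha> * xpow \<beta>)"

text \<open>\<open>\<langle>A, B\<rangle> = tr(A\<^sup>T B)\<close> for a real matrix \<open>A\<close> and a polynomial matrix \<open>B\<close>.\<close>

definition pairing :: "'i set \<Rightarrow> ('i \<Rightarrow> 'i \<Rightarrow> real) \<Rightarrow> ('i \<Rightarrow> 'i \<Rightarrow> 'n rpoly) \<Rightarrow> 'n rpoly" where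
  "pairing S A B = (\<Sum>i\<in>S. \<Sum>j\<in>S. pconst (A i j) * B i j)"

definition psd_on :: "'i set \<Rightarrow> ('i \<Rightarrow> 'i \<Rightarrow> real) \<Rightarrow> bool" where
  "psd_on S A \<longleftrightarrow> (\<forall>i\<in>S. \<forall>j\<in>S. A i j = A j i) \<and>
     (\<forall>v. 0 \<le> (\<Sum>i\<in>S. \<Sum>j\<in>S. v i * A i j * v j))"

text \<open>Entries outside \<open>S \<times> S\<close> are normalised to \<open>0\<close>, so that a function is one matrix of size \<open>|S|\<close>.\<close>

definition psd_cone :: "'i set \<Rightarrow> ('i \<Rightarrow> 'i \<Rightarrow> real) set" where
  "psd_cone S = {A. psd_on S A \<and> (\<forall>i j. i \<notin> S \<or> j \<notin> S \<longrightarrow> A i j = 0)}"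


section \<open>Conic programs and their duals\<close>

text \<open>
  Maximise \<open>gain x\<close> over \<open>x \<in> cone\<close> subject to \<open>lhs i x = rhs i\<close> for all \<open>i \<in> eqs\<close>;
  \<open>gain\<close> and all \<open>lhs i\<close> are linear functionals on the space of variables.
\<close>

record ('i, 'v) conic_program =
  gain :: "'v \<Rightarrow> real"
  cone :: "'v set"
  eqs :: "'i set"
  lhs :: "'i \<Rightarrow> 'v \<Rightarrow> real"
  rhs :: "'i \<Rightarrow> real"

text \<open>Minimise \<open>cost y\<close> over \<open>y \<in> feasible\<close>.\<close>

record 'y minimization =
  feasible :: "'y set"
  cost :: "'y \<Rightarrow> real"

text \<open>\<open>\<real>\<^sup>I\<close>, realised as the functions vanishing outside \<open>I\<close>.\<close>

definition rspace :: "'i set \<Rightarrow> ('i \<Rightarrow> real) set" where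
  "rspace I = {y. \<forall>i. i \<notin> I \<longrightarrow> y i = 0}"

text \<open>
  The dual cone \<open>K\<^sup>*\<close> is taken in the dual space, as a set of functionals; no inner product
  on the variables has to be chosen. For \<open>max \<langle>c, x\<rangle>\<close> subject to \<open>\<A> x = b\<close>, \<open>x \<in> K\<close>
  the dual is \<open>min \<langle>b, y\<rangle>\<close> subject to \<open>\<A>\<^sup>* y - c \<in> K\<^sup>*\<close>.
\<close>

definition dual_cone :: "'v set \<Rightarrow> ('v \<Rightarrow> real) set" where
  "dual_cone K = {\<phi>. \<forall>x\<in>K. 0 \<le> \<phi> x}"

definition conic_dual :: "('i, 'v) conic_program \<Rightarrow> ('i \<Rightarrow> real) minimization" where
  "conic_dual \<P> = \<lparr>
     feasible = {y \<in> rspace (eqs \<P>).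
       (\<lambda>x. (\<Sum>i\<in>eqs \<P>. y i * lhs \<P> i x) - gain \<P> x) \<in> dual_cone (cone \<P>)},
     cost = (\<lambda>y. \<Sum>i\<in>eqs \<P>. y i * rhs \<P> i)\<rparr>"


section \<open>The semidefinite program of the hierarchy\<close>

definition half_deg :: "('n::finite) rpoly mat \<Rightarrow> nat" where
  "half_deg G = nat \<lceil>real (mat_deg G) / 2\<rceil>"

text \<open>\<open>gram_order G r = \<lceil>k/2\<rceil>\<close> for \<open>k = \<lfloor>r/l\<rfloor> - 1\<close>, which is nonnegative when \<open>r \<ge> l > 0\<close>.\<close>

definition gram_order :: "('n::finite) rpoly mat \<Rightarrow> nat \<Rightarrow> nat" where
  "gram_order G r = nat \<lceil>(real_of_int \<lfloor>real r / real (half_deg G)\<rfloor> - 1) / 2\<rceil>"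

text \<open>Variables \<open>(t, X, X\<^sub>1, Y, Z)\<close>.\<close>

type_synonym 'n sdp_var =
  "real \<times> ('n expo \<Rightarrow> 'n expo \<Rightarrow> real) \<times> ('n expo \<Rightarrow> 'n expo \<Rightarrow> real) \<times>
   (nat \<Rightarrow> nat \<Rightarrow> real) \<times> (nat \<Rightarrow> nat \<Rightarrow> real)"

definition sdp_cone :: "('n::finite) rpoly mat \<Rightarrow> nat \<Rightarrow> 'n sdp_var set" where
  "sdp_cone G r = UNIV \<times> psd_cone (expos r) \<times> psd_cone (expos (r - 1)) \<times>
     psd_cone {..gram_order G r} \<times> psd_cone {..<gram_order G r}"

definition sdp_poly :: "('n::finite) rpoly mat \<Rightarrow> nat \<Rightarrow> 'n sdp_var \<Rightarrow> 'n rpoly" where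
  "sdp_poly G r = (\<lambda>(t, X, X\<^sub>1, Y, Z).
     pconst t + pairing (expos r) X (mono_mat 1) + pairing (expos (r - 1)) X\<^sub>1 (mono_mat ball_poly)
     + pairing {..gram_order G r} Y (P_mat G) + pairing {..<gram_order G r} Z (Q_mat G))"

text \<open>
  The identity \<open>f = sdp_poly G r (t, X, X\<^sub>1, Y, Z)\<close> is imposed for the coefficients in
  \<open>expos (2 * r)\<close>. If \<open>\<lfloor>r/l\<rfloor>\<close> is even, \<open>P_mat\<close> and \<open>Q_mat\<close> may have monomials of degree
  above \<open>2 * r\<close>; these enter neither here nor in \<open>riesz\<close> below.
\<close>

definition hierarchy_sdp ::
  "('n::finite) rpoly \<Rightarrow> 'n rpoly mat \<Rightarrow> nat \<Rightarrow> ('n expo, 'n sdp_var) conic_program" where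
  "hierarchy_sdp f G r = \<lparr>
     gain = (\<lambda>(t, X, X\<^sub>1, Y, Z). t),
     cone = sdp_cone G r,
     eqs = expos (2 * r),
     lhs = (\<lambda>\<alpha> x. Poly_Mapping.lookup (sdp_poly G r x) \<alpha>),
     rhs = (\<lambda>\<alpha>. Poly_Mapping.lookup f \<alpha>)\<rparr>"


section \<open>Riesz functional, moment and localizing matrices\<close>

text \<open>A truncated sequence is a member of \<open>rspace (expos (2 * r))\<close>, that is, extended by \<open>0\<close>.\<close>

definition riesz :: "('n expo \<Rightarrow> real) \<Rightarrow> 'n rpoly \<Rightarrow> real" where
  "riesz y p = (\<Sum>\<alpha>\<in>Poly_Mapping.keys p. Poly_Mapping.lookup p \<alpha> * y \<alpha>)"

definition riesz_mat ::
  "('n expo \<Rightarrow> real) \<Rightarrow> ('i \<Rightarrow> 'i \<Rightarrow> 'n rpoly) \<Rightarrow> 'i \<Rightarrow> 'i \<Rightarrow> real" where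
  "riesz_mat y M i j = riesz y (M i j)"

definition moment_mat :: "('n expo \<Rightarrow> real) \<Rightarrow> 'n expo \<Rightarrow> 'n expo \<Rightarrow> real" where
  "moment_mat y = riesz_mat y (mono_mat 1)"

definition localizing_mat :: "'n rpoly \<Rightarrow> ('n expo \<Rightarrow> real) \<Rightarrow> 'n expo \<Rightarrow> 'n expo \<Rightarrow> real" where
  "localizing_mat g y = riesz_mat y (mono_mat g)"

end

theory Submission
  imports Defs
begin

text \<open>
  Multiplying the coefficient identities by \<open>y\<close> and summing applies the Riesz functional of \<open>y\<close> to
  the right-hand side of the identity, so the dual constraint says that
  \<open>t (y 0 - 1) + \<langle>X, M\<rangle> + \<langle>X\<^sub>1, M\<^sub>1\<rangle> + \<langle>Y, L\<^sub>y P\<rangle> + \<langle>Z, L\<^sub>y Q\<rangle>\<close> is nonnegative for all real \<open>t\<close> and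
  all positive semidefinite \<open>X, X\<^sub>1, Y, Z\<close>. The variables are independent, so each term is
  nonnegative on its own, and self-duality of the semidefinite cone gives the constraints on \<open>y\<close>.
\<close>

section \<open>The cone of positive semidefinite matrices is self-dual\<close>

lemma psd_onD_sym: "psd_on S A \<Longrightarrow> i \<in> S \<Longrightarrow> j \<in> S \<Longrightarrow> A i j = A j i"
  by (simp add: psd_on_def)

lemma psd_onD_nonneg: "psd_on S A \<Longrightarrow> 0 \<le> (\<Sum>i\<in>S. \<Sum>j\<in>S. v i * A i j * v j)"
  by (simp add: psd_on_def)

text \<open>Isolates \<open>v a\<close>: the form becomes a quadratic polynomial in this one
  coordinate, ready for completing the square.\<close>

lemma quadratic_form_insert:
  fixes A :: "'i \<Rightarrow> 'i \<Rightarrow> real"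
  assumes "finite S" "a \<notin> S" "\<And>i. i \<in> S \<Longrightarrow> A i a = A a i"
  shows "(\<Sum>i\<in>insert a S. \<Sum>j\<in>insert a S. v i * A i j * v j) =
    A a a * (v a)\<^sup>2 + 2 * v a * (\<Sum>i\<in>S. A a i * v i) + (\<Sum>i\<in>S. \<Sum>j\<in>S. v i * A i j * v j)"
proof -
  have "(\<Sum>i\<in>S. v i * A i a * v a) = v a * (\<Sum>i\<in>S. A a i * v i)"
    unfolding sum_distrib_left by (rule sum.cong) (simp_all add: assms(3))
  moreover have "(\<Sum>j\<in>S. v a * A a j * v j) = v a * (\<Sum>i\<in>S. A a i * v i)"
    unfolding sum_distrib_left by (simp add: mult.assoc)
  ultimately show ?thesis
    using assms(1,2) by (simp add: sum.distrib power2_eq_square)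
qed

lemma psd_on_subset:
  assumes "psd_on S A" "finite S" "T \<subseteq> S"
  shows "psd_on T A"
  unfolding psd_on_def
proof (intro conjI ballI allI)
  fix i j assume "i \<in> T" "j \<in> T"
  then show "A i j = A j i" using assms psd_onD_sym by (metis subsetD)
next
  fix v :: "'a \<Rightarrow> real"
  \<comment> \<open>Extending \<open>v\<close> by zero does not change the value of the form, so a
    principal submatrix inherits nonnegativity.\<close>
  define w where "w i = (if i \<in> T then v i else 0)" for i
  have "(\<Sum>i\<in>T. \<Sum>j\<in>T. v i * A i j * v j) = (\<Sum>i\<in>T. \<Sum>j\<in>T. w i * A i j * w j)"
    by (intro sum.cong) (auto simp: w_def)
  also have "\<dots> = (\<Sum>i\<in>T. \<Sum>j\<in>S. w i * A i j * w j)"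
    by (intro sum.cong refl sum.mono_neutral_left assms) (auto simp: w_def)
  also have "\<dots> = (\<Sum>i\<in>S. \<Sum>j\<in>S. w i * A i j * w j)"
    by (intro sum.mono_neutral_left assms) (auto simp: w_def)
  finally show "0 \<le> (\<Sum>i\<in>T. \<Sum>j\<in>T. v i * A i j * v j)"
    using psd_onD_nonneg[OF assms(1), of w] by simp
qed

lemma psd_on_diag_nonneg:
  assumes "psd_on S A" "finite S" "a \<in> S"
  shows "0 \<le> A a a"
proof -
  have "psd_on {a} A" using assms psd_on_subset by (metis empty_subsetI insert_subset)
  from psd_onD_nonneg[OF this, of "\<lambda>_. 1"] show ?thesis by simp
qed

text \<open>On the principal submatrix for \<open>{a, i}\<close> the form at \<open>(s, 1)\<close>
  is affine in \<open>s\<close> with slope \<open>2 * A a i\<close>; it can stay nonnegative only if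
  the slope vanishes.\<close>

lemma psd_on_zero_diag:
  assumes "psd_on S A" "finite S" "a \<in> S" "i \<in> S" "A a a = 0"
  shows "A a i = 0"
proof (rule ccontr)
  assume nz: "A a i \<noteq> 0"
  with assms have ne: "a \<noteq> i" by auto
  have psd: "psd_on {a, i} A" using assms psd_on_subset by (metis empty_subsetI insert_subset)
  \<comment> \<open>At this \<open>s\<close> the affine function takes the value
    \<open>-1\<close>.\<close>
  define s where "s = - (A i i + 1) / (2 * A a i)"
  have "0 \<le> 2 * s * A a i + A i i"
    using psd_onD_nonneg[OF psd, of "\<lambda>k. if k = a then s else 1"] ne assms(5)
      psd_onD_sym[OF psd, of a i] by simp
  moreover have "2 * s * A a i = - (A i i + 1)" using nz by (simp add: s_def)
  ultimately show False by simp
qed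

text \<open>Minimizing the form of \<open>A\<close> over the coordinate at \<open>a\<close> leaves
  exactly the form of the Schur complement in the other coordinates.\<close>

lemma psd_on_schur_complement:
  assumes psd: "psd_on (insert a S) A" and "finite S" "a \<notin> S" and pos: "0 < A a a"
  shows "psd_on S (\<lambda>i j. A i j - A a i * A a j / A a a)"
  unfolding psd_on_def
proof (intro conjI ballI allI)
  fix i j assume "i \<in> S" "j \<in> S"
  then show "A i j - A a i * A a j / A a a = A j i - A a j * A a i / A a a"
    using psd_onD_sym[OF psd, of i j] by simp
next
  fix v :: "'a \<Rightarrow> real"
  define c where "c = (\<Sum>i\<in>S. A a i * v i)"
  \<comment> \<open>The new coordinate minimizes \<open>A a a * s * s + 2 * s * c\<close> over
    \<open>s\<close>; the minimum is \<open>- (c * c / A a a)\<close>.\<close>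
  define w where "w = v(a := - c / A a a)"
  have wv: "w i = v i" if "i \<in> S" for i using that assms(3) by (auto simp: w_def)
  have c: "(\<Sum>i\<in>S. A a i * w i) = c"
    unfolding c_def by (rule sum.cong) (simp_all add: wv)
  have q: "(\<Sum>i\<in>S. \<Sum>j\<in>S. w i * A i j * w j) = (\<Sum>i\<in>S. \<Sum>j\<in>S. v i * A i j * v j)"
    by (intro sum.cong refl) (simp_all add: wv)
  have "c * c = (\<Sum>i\<in>S. \<Sum>j\<in>S. (A a i * v i) * (A a j * v j))"
    unfolding c_def by (rule sum_product)
  then have "(\<Sum>i\<in>S. \<Sum>j\<in>S. v i * (A i j - A a i * A a j / A a a) * v j) =
      (\<Sum>i\<in>S. \<Sum>j\<in>S. v i * A i j * v j) - c * c / A a a"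
    by (simp add: sum_subtractf[symmetric] sum_divide_distrib algebra_simps)
  also have "\<dots> = (\<Sum>i\<in>insert a S. \<Sum>j\<in>insert a S. w i * A i j * w j)"
  proof -
    have "w a = - c / A a a" by (simp add: w_def)
    then have "A a a * (w a)\<^sup>2 + 2 * w a * c = - (c * c / A a a)"
      using pos by (simp add: power2_eq_square)
    then show ?thesis
      using quadratic_form_insert[of S a A w] assms(2,3) psd_onD_sym[OF psd] c q by simp
  qed
  also have "\<dots> \<ge> 0" by (rule psd_onD_nonneg[OF psd])
  finally show "0 \<le> (\<Sum>i\<in>S. \<Sum>j\<in>S. v i * (A i j - A a i * A a j / A a a) * v j)" .
qed

text \<open>
  Symmetric elimination peels off a rank-one matrix \<open>u u\<^sup>T / A a a\<close> at every step, where \<open>u\<close> is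
  row \<open>a\<close> of \<open>A\<close>; its pairing with \<open>M\<close> is a nonnegative multiple of \<open>u\<^sup>T M u\<close>.
\<close>

lemma psd_pairing_nonneg:
  assumes "finite S" "psd_on S A" "psd_on S M"
  shows "0 \<le> (\<Sum>i\<in>S. \<Sum>j\<in>S. A i j * M i j)"
  using assms
\<comment> \<open>\<open>A\<close> must vary, since each elimination step replaces it, while
  \<open>M\<close> is only restricted.\<close>
proof (induction S arbitrary: A rule: finite_induct)
  case empty
  then show ?case by simp
next
  case (insert a S)
  let ?T = "insert a S"
  have fin: "finite ?T" using insert.hyps by simp
  have sym: "A i a = A a i" if "i \<in> ?T" for i
    using psd_onD_sym[OF insert.prems(1), of i a] that by simp
  have MS: "psd_on S M" using psd_on_subset[OF insert.prems(2) fin] by auto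
  consider "A a a = 0" | "0 < A a a"
    using psd_on_diag_nonneg[OF insert.prems(1) fin, of a] by fastforce
  then show ?case
  proof cases
    case 1
    \<comment> \<open>A zero pivot comes with a zero row and column, so nothing has to be
      eliminated.\<close>
    have z: "A a i = 0" "A i a = 0" if "i \<in> ?T" for i
      using psd_on_zero_diag[OF insert.prems(1) fin _ that 1] sym[OF that] by simp_all
    have "(\<Sum>i\<in>?T. \<Sum>j\<in>?T. A i j * M i j) = (\<Sum>i\<in>S. \<Sum>j\<in>S. A i j * M i j)"
      using insert.hyps z by simp
    moreover have "psd_on S A" using psd_on_subset[OF insert.prems(1) fin] by auto
    ultimately show ?thesis using insert.IH MS by simp
  next
    case 2
    define B where "B i j = A i j - A a i * A a j / A a a" for i j
    \<comment> \<open>Elimination clears row and column \<open>a\<close>, so the pairing of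
      \<open>B\<close> with \<open>M\<close> over \<open>S\<close> is already the one over
      \<open>?T\<close>.\<close>
    have z: "B a i = 0" "B i a = 0" if "i \<in> ?T" for i
      using 2 sym[OF that] by (simp_all add: B_def)
    have "psd_on S B"
      unfolding B_def by (rule psd_on_schur_complement) (use insert.prems(1) insert.hyps 2 in auto)
    then have "0 \<le> (\<Sum>i\<in>S. \<Sum>j\<in>S. B i j * M i j)" using insert.IH MS by blast
    also have "\<dots> = (\<Sum>i\<in>?T. \<Sum>j\<in>?T. B i j * M i j)"
      using insert.hyps z by simp
    finally have B: "0 \<le> (\<Sum>i\<in>?T. \<Sum>j\<in>?T. B i j * M i j)" .
    have "(\<Sum>i\<in>?T. \<Sum>j\<in>?T. A i j * M i j) = (\<Sum>i\<in>?T. \<Sum>j\<in>?T. B i j * M i j) +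
        (\<Sum>i\<in>?T. \<Sum>j\<in>?T. A a i * M i j * A a j) / A a a"
      unfolding sum_divide_distrib sum.distrib[symmetric]
      by (intro sum.cong refl) (simp add: B_def algebra_simps)
    then show ?thesis
      using B psd_onD_nonneg[OF insert.prems(2), of "A a"] 2 by simp
  qed
qed

lemma zero_in_psd_cone: "(\<lambda>_ _. 0) \<in> psd_cone S"
  by (simp add: psd_cone_def psd_on_def)

text \<open>The test elements \<open>v v^T\<close> of the cone: the form at \<open>w\<close> is the
  squared inner product of \<open>w\<close> and \<open>v\<close>. The conditional meets the
  normalisation in \<open>psd_cone\<close>.\<close>

lemma rank_one_in_psd_cone:
  "(\<lambda>i j. if i \<in> S \<and> j \<in> S then v i * v j else 0) \<in> psd_cone S"
proof -
  have "0 \<le> (\<Sum>i\<in>S. \<Sum>j\<in>S. w i * (if i \<in> S \<and> j \<in> S then v i * v j else 0) * w j)"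
    for w :: "'a \<Rightarrow> real"
  proof -
    have "(\<Sum>i\<in>S. \<Sum>j\<in>S. w i * (if i \<in> S \<and> j \<in> S then v i * v j else 0) * w j) =
        (\<Sum>i\<in>S. w i * v i) * (\<Sum>j\<in>S. w j * v j)"
      unfolding sum_product by (intro sum.cong refl) simp
    then show ?thesis by simp
  qed
  then show ?thesis by (auto simp: psd_cone_def psd_on_def)
qed

text \<open>Pairing with \<open>v v^T\<close> evaluates the form of \<open>M\<close> at
  \<open>v\<close>, so rank-one tests force semidefiniteness; the converse is
  \<open>psd_pairing_nonneg\<close>. Symmetry of \<open>M\<close> is assumed because pairings with
  symmetric matrices cannot detect a skew part.\<close>

lemma psd_cone_self_dual:
  assumes "finite S" "\<And>i j. M i j = M j i"
  shows "(\<forall>A\<in>psd_cone S. 0 \<le> (\<Sum>i\<in>S. \<Sum>j\<in>S. A i j * M i j)) \<longleftrightarrow> psd_on S M"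
proof
  assume *: "\<forall>A\<in>psd_cone S. 0 \<le> (\<Sum>i\<in>S. \<Sum>j\<in>S. A i j * M i j)"
  have "0 \<le> (\<Sum>i\<in>S. \<Sum>j\<in>S. v i * M i j * v j)" for v
  proof -
    have "(\<Sum>i\<in>S. \<Sum>j\<in>S. v i * M i j * v j) =
        (\<Sum>i\<in>S. \<Sum>j\<in>S. (if i \<in> S \<and> j \<in> S then v i * v j else 0) * M i j)"
      by (intro sum.cong refl) simp
    then show ?thesis using bspec[OF * rank_one_in_psd_cone] by simp
  qed
  then show "psd_on S M" using assms(2) by (simp add: psd_on_def)
next
  assume "psd_on S M"
  then show "\<forall>A\<in>psd_cone S. 0 \<le> (\<Sum>i\<in>S. \<Sum>j\<in>S. A i j * M i j)"
    using psd_pairing_nonneg[OF assms(1)] by (simp add: psd_cone_def)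
qed


section \<open>The Riesz functional\<close>

text \<open>Each single exponent is bounded by the total degree, so \<open>lookup\<close> embeds
  \<open>expos r\<close> into the functions with values in \<open>{..r}\<close>.\<close>

lemma finite_expos: "finite (expos r :: ('n::finite) expo set)"
proof -
  have "Poly_Mapping.lookup ` (expos r :: 'n expo set) \<subseteq> UNIV \<rightarrow>\<^sub>E {..r}"
  proof (rule image_subsetI)
    fix \<alpha> :: "'n expo"
    assume "\<alpha> \<in> expos r"
    then have "(\<Sum>i\<in>UNIV. Poly_Mapping.lookup \<alpha> i) \<le> r"
      by (simp add: expos_def expo_deg_def)
    moreover have "Poly_Mapping.lookup \<alpha> i \<le> (\<Sum>i\<in>UNIV. Poly_Mapping.lookup \<alpha> i)" for i
      by (rule member_le_sum) simp_all
    ultimately show "Poly_Mapping.lookup \<alpha> \<in> UNIV \<rightarrow>\<^sub>E {..r}"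
      using order_trans by (auto simp: PiE_UNIV_domain)
  qed
  then have "finite (Poly_Mapping.lookup ` (expos r :: 'n expo set))"
    by (rule finite_subset) (simp add: finite_PiE)
  then show ?thesis
    by (rule finite_imageD) (simp add: inj_on_def Poly_Mapping.lookup_inject)
qed

lemma keys_subset_expos: "Poly_Mapping.keys p \<subseteq> expos d" if "pdeg p \<le> d"
proof
  fix \<alpha> assume "\<alpha> \<in> Poly_Mapping.keys p"
  then have "expo_deg \<alpha> \<le> pdeg p" unfolding pdeg_def by (intro Max_ge) auto
  then show "\<alpha> \<in> expos d" using that by (simp add: expos_def)
qed

text \<open>Provides a common index set where key sets differ, for instance after cancellation in a
  sum.\<close>

lemma riesz_superset:
  assumes "finite K" "Poly_Mapping.keys p \<subseteq> K"
  shows "riesz y p = (\<Sum>\<alpha>\<in>K. Poly_Mapping.lookup p \<alpha> * y \<alpha>)"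
  unfolding riesz_def using assms
  by (intro sum.mono_neutral_left) (auto simp: in_keys_iff)

text \<open>Monomials of \<open>p\<close> outside \<open>I\<close> may occur, but there
  \<open>y\<close> vanishes; this makes the truncated coefficient identities compatible with the
  Riesz functional.\<close>

lemma riesz_rspace:
  assumes "finite I" "y \<in> rspace I"
  shows "riesz y p = (\<Sum>\<alpha>\<in>I. y \<alpha> * Poly_Mapping.lookup p \<alpha>)"
proof -
  have "riesz y p = (\<Sum>\<alpha>\<in>Poly_Mapping.keys p \<union> I. Poly_Mapping.lookup p \<alpha> * y \<alpha>)"
    using assms by (intro riesz_superset) auto
  also have "\<dots> = (\<Sum>\<alpha>\<in>I. Poly_Mapping.lookup p \<alpha> * y \<alpha>)"
    using assms by (intro sum.mono_neutral_right) (auto simp: rspace_def)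
  finally show ?thesis by (simp add: mult.commute)
qed

lemma riesz_add: "riesz y (p + q) = riesz y p + riesz y q"
proof -
  let ?K = "Poly_Mapping.keys p \<union> Poly_Mapping.keys q"
  have "riesz y (p + q) = (\<Sum>\<alpha>\<in>?K. Poly_Mapping.lookup (p + q) \<alpha> * y \<alpha>)"
    by (intro riesz_superset) (simp_all add: keys_add)
  also have "\<dots> = (\<Sum>\<alpha>\<in>?K. Poly_Mapping.lookup p \<alpha> * y \<alpha>) +
      (\<Sum>\<alpha>\<in>?K. Poly_Mapping.lookup q \<alpha> * y \<alpha>)"
    by (simp add: lookup_add sum.distrib distrib_right)
  also have "\<dots> = riesz y p + riesz y q"
    using riesz_superset[of ?K p y] riesz_superset[of ?K q y] by simp
  finally show ?thesis .
qed

lemma riesz_zero: "riesz y 0 = 0"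
  by (simp add: riesz_def)

lemma riesz_sum: "riesz y (\<Sum>i\<in>S. p i) = (\<Sum>i\<in>S. riesz y (p i))"
  by (induction S rule: infinite_finite_induct) (simp_all add: riesz_zero riesz_add)

lemma riesz_pconst: "riesz y (pconst c) = c * y 0"
  by (simp add: pconst_def riesz_def)

lemma lookup_pconst_mult: "Poly_Mapping.lookup (pconst c * p) \<alpha> = c * Poly_Mapping.lookup p \<alpha>"
  unfolding pconst_def mult_map_scale_conv_mult[symmetric]
  by (simp add: Poly_Mapping.map.rep_eq when_def)

lemma riesz_pconst_mult: "riesz y (pconst c * p) = c * riesz y p"
proof -
  have "riesz y (pconst c * p) =
      (\<Sum>\<alpha>\<in>Poly_Mapping.keys p. Poly_Mapping.lookup (pconst c * p) \<alpha> * y \<alpha>)"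
    by (intro riesz_superset) (auto simp: in_keys_iff lookup_pconst_mult)
  then show ?thesis
    by (simp add: lookup_pconst_mult riesz_def sum_distrib_left mult.assoc)
qed

lemma riesz_pairing: "riesz y (pairing S A B) = (\<Sum>i\<in>S. \<Sum>j\<in>S. A i j * riesz_mat y B i j)"
  by (simp add: pairing_def riesz_sum riesz_pconst_mult riesz_mat_def)

text \<open>The adjoint of the constraint map: each variable of the program is paired with its own
  matrix built from \<open>y\<close>.\<close>

lemma riesz_sdp_poly:
  "riesz y (sdp_poly G r (t, X, X\<^sub>1, Y, Z)) = t * y 0
    + (\<Sum>i\<in>expos r. \<Sum>j\<in>expos r. X i j * moment_mat y i j)
    + (\<Sum>i\<in>expos (r - 1). \<Sum>j\<in>expos (r - 1). X\<^sub>1 i j * localizing_mat ball_poly y i j)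
    + (\<Sum>i\<le>gram_order G r. \<Sum>j\<le>gram_order G r. Y i j * riesz_mat y (P_mat G) i j)
    + (\<Sum>i<gram_order G r. \<Sum>j<gram_order G r. Z i j * riesz_mat y (Q_mat G) i j)"
  by (simp add: sdp_poly_def riesz_add riesz_pconst riesz_pairing moment_mat_def localizing_mat_def)

lemma riesz_mat_symmetric: "(\<And>i j. M i j = M j i) \<Longrightarrow> riesz_mat y M i j = riesz_mat y M j i"
  unfolding riesz_mat_def by metis

lemma mono_mat_symmetric: "mono_mat g \<alpha> \<beta> = mono_mat g \<beta> \<alpha>"
  by (simp add: mono_mat_def mult.commute)

text \<open>The entries depend on \<open>i + j\<close> only, a Hankel structure shared by
  \<open>Q_mat\<close>.\<close>

lemma P_mat_symmetric: "P_mat G i j = P_mat G j i"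
  by (simp add: P_mat_def add.commute)

lemma Q_mat_symmetric: "Q_mat G i j = Q_mat G j i"
  by (simp add: Q_mat_def add.commute)


section \<open>The dual program\<close>

text \<open>The dual cone of the line of all \<open>t\<close> is \<open>{0}\<close>; this becomes the constraint \<open>y 0 = 1\<close>.\<close>

lemma nonneg_on_product_iff:
  fixes c :: real and \<phi> :: "'a \<Rightarrow> real" and \<psi> :: "'b \<Rightarrow> real" and \<chi> :: "'c \<Rightarrow> real" and \<omega> :: "'d \<Rightarrow> real"
  assumes "a0 \<in> A" "\<phi> a0 = 0" "b0 \<in> B" "\<psi> b0 = 0" "c0 \<in> C" "\<chi> c0 = 0" "d0 \<in> D" "\<omega> d0 = 0"
  shows "(\<forall>t. \<forall>a\<in>A. \<forall>b\<in>B. \<forall>c'\<in>C. \<forall>d\<in>D. 0 \<le> t * c + \<phi> a + \<psi> b + \<chi> c' + \<omega> d) \<longleftrightarrow>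
    c = 0 \<and> (\<forall>a\<in>A. 0 \<le> \<phi> a) \<and> (\<forall>b\<in>B. 0 \<le> \<psi> b) \<and> (\<forall>c\<in>C. 0 \<le> \<chi> c) \<and> (\<forall>d\<in>D. 0 \<le> \<omega> d)"
    (is "?L \<longleftrightarrow> ?R")
proof
  assume L: ?L
  have le: "0 \<le> t * c + \<phi> a + \<psi> b + \<chi> c' + \<omega> d"
    if "a \<in> A" "b \<in> B" "c' \<in> C" "d \<in> D" for t a b c' d
    using L that by blast
  \<comment> \<open>At the base points only \<open>t * c\<close> survives, and
    \<open>t = - c\<close> turns it into \<open>- c * c\<close>.\<close>
  from le[OF assms(1,3,5,7), of "- c"] assms have "c = 0"
    by (auto simp: mult_le_0_iff)
  moreover have "0 \<le> \<phi> a" if "a \<in> A" for a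
    using le[OF that assms(3,5,7), of 0] assms by simp
  moreover have "0 \<le> \<psi> b" if "b \<in> B" for b
    using le[OF assms(1) that assms(5,7), of 0] assms by simp
  moreover have "0 \<le> \<chi> c'" if "c' \<in> C" for c'
    using le[OF assms(1,3) that assms(7), of 0] assms by simp
  moreover have "0 \<le> \<omega> d" if "d \<in> D" for d
    using le[OF assms(1,3,5) that, of 0] assms by simp
  ultimately show ?R by blast
qed simp

theorem corollary4p1:
  fixes f :: "('n::finite) rpoly"
    and G :: "'n rpoly mat"
    and m r :: nat
  assumes "m > 0"
    and "G \<in> carrier_mat m m"
    and "transpose_mat G = G"
    and "\<And>x :: 'n \<Rightarrow> real. (\<Sum>i\<in>UNIV. (x i)\<^sup>2) \<le> 1 \<Longrightarrow> spectral_radius (mat_eval x G) \<le> 1"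
    and "half_deg G \<le> r"
    and "pdeg f \<le> 2 * r"
  shows "conic_dual (hierarchy_sdp f G r) =
    \<lparr>feasible = {y \<in> rspace (expos (2 * r)).
        y 0 = 1 \<and>
        psd_on (expos r) (moment_mat y) \<and>
        psd_on (expos (r - 1)) (localizing_mat ball_poly y) \<and>
        psd_on {..gram_order G r} (riesz_mat y (P_mat G)) \<and>
        psd_on {..<gram_order G r} (riesz_mat y (Q_mat G))},
     cost = (\<lambda>y. riesz y f)\<rparr>"
proof -
  let ?P = "hierarchy_sdp f G r"
  have feasible: "(\<lambda>x. (\<Sum>\<alpha>\<in>eqs ?P. y \<alpha> * lhs ?P \<alpha> x) - gain ?P x) \<in> dual_cone (cone ?P) \<longleftrightarrow>
      y 0 = 1 \<and>
      psd_on (expos r) (moment_mat y) \<and>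
      psd_on (expos (r - 1)) (localizing_mat ball_poly y) \<and>
      psd_on {..gram_order G r} (riesz_mat y (P_mat G)) \<and>
      psd_on {..<gram_order G r} (riesz_mat y (Q_mat G))" (is "?D \<longleftrightarrow> ?R")
    if "y \<in> rspace (expos (2 * r))" for y
  proof -
    let ?pair = "\<lambda>S M A. \<Sum>i\<in>S. \<Sum>j\<in>S. A i j * M i j :: real"
    have lhs: "(\<Sum>\<alpha>\<in>eqs ?P. y \<alpha> * lhs ?P \<alpha> x) = riesz y (sdp_poly G r x)" for x
      by (simp add: hierarchy_sdp_def riesz_rspace[OF finite_expos that])
    \<comment> \<open>Subtracting the gain \<open>t\<close> changes the coefficient of
      \<open>t\<close> from \<open>y 0\<close> to \<open>y 0 - 1\<close>.\<close>
    have "?D \<longleftrightarrow> (\<forall>t. \<forall>X\<in>psd_cone (expos r). \<forall>X\<^sub>1\<in>psd_cone (expos (r - 1)).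
        \<forall>Y\<in>psd_cone {..gram_order G r}. \<forall>Z\<in>psd_cone {..<gram_order G r}.
        0 \<le> t * (y 0 - 1) + ?pair (expos r) (moment_mat y) X +
          ?pair (expos (r - 1)) (localizing_mat ball_poly y) X\<^sub>1 +
          ?pair {..gram_order G r} (riesz_mat y (P_mat G)) Y +
          ?pair {..<gram_order G r} (riesz_mat y (Q_mat G)) Z)"
      unfolding lhs
      by (simp add: hierarchy_sdp_def dual_cone_def sdp_cone_def Ball_def riesz_sdp_poly
          algebra_simps) blast
    \<comment> \<open>The zero matrix lies in every cone and has pairing zero, so it is the base
      point in each factor.\<close>
    also have "\<dots> \<longleftrightarrow> y 0 - 1 = 0 \<and>
        (\<forall>X\<in>psd_cone (expos r). 0 \<le> ?pair (expos r) (moment_mat y) X) \<and>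
        (\<forall>X\<^sub>1\<in>psd_cone (expos (r - 1)).
          0 \<le> ?pair (expos (r - 1)) (localizing_mat ball_poly y) X\<^sub>1) \<and>
        (\<forall>Y\<in>psd_cone {..gram_order G r}.
          0 \<le> ?pair {..gram_order G r} (riesz_mat y (P_mat G)) Y) \<and>
        (\<forall>Z\<in>psd_cone {..<gram_order G r}.
          0 \<le> ?pair {..<gram_order G r} (riesz_mat y (Q_mat G)) Z)"
      by (rule nonneg_on_product_iff[where ?a0.0 = "\<lambda>_ _. 0" and ?b0.0 = "\<lambda>_ _. 0"
            and ?c0.0 = "\<lambda>_ _. 0" and ?d0.0 = "\<lambda>_ _. 0"]) (simp_all add: zero_in_psd_cone)
    also have "\<dots> \<longleftrightarrow> ?R"
    proof -
      have "moment_mat y \<alpha> \<beta> = moment_mat y \<beta> \<alpha>"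
        "localizing_mat ball_poly y \<alpha> \<beta> = localizing_mat ball_poly y \<beta> \<alpha>" for \<alpha> \<beta>
        unfolding moment_mat_def localizing_mat_def
        by (rule riesz_mat_symmetric, rule mono_mat_symmetric)+
      moreover have "riesz_mat y (P_mat G) i j = riesz_mat y (P_mat G) j i"
        "riesz_mat y (Q_mat G) i j = riesz_mat y (Q_mat G) j i" for i j
        by (rule riesz_mat_symmetric, rule P_mat_symmetric Q_mat_symmetric)+
      ultimately show ?thesis
        by (simp only: psd_cone_self_dual finite_expos finite_atMost finite_lessThan
            right_minus_eq)
    qed
    finally show ?thesis .
  qed
  have eqs: "eqs ?P = expos (2 * r)"
    by (simp add: hierarchy_sdp_def)
  \<comment> \<open>The cost functions must agree at every \<open>y\<close>, also outside
    \<open>rspace\<close>; the degree bound on \<open>f\<close> puts all its monomials among the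
    equations.\<close>
  have cost: "(\<Sum>\<alpha>\<in>eqs ?P. y \<alpha> * rhs ?P \<alpha>) = riesz y f" for y
    using riesz_superset[OF finite_expos keys_subset_expos[OF assms(6)]]
    by (simp add: hierarchy_sdp_def mult.commute)
  show ?thesis
    unfolding conic_dual_def cost using feasible by (auto simp: eqs)
qed

end
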